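(* Let $\mathbf{G}\in\mathbb{C}^{M\times K}$ be fixed. Then the optimization problem $$\min_{\{\mathbf{F}_i\}_{i=1}^{L}}\ \mathsf{MSE}\big(\{\mathbf{F}_i\}_{i=1}^L,\mathbf{G}\big)\quad\text{s.t.}\quad \mathrm{Tr}\big\{\mathbf{F}_i(\mathbf{K}_i\mathbf{\Sigma}_{\mathbf{s}}\mathbf{K}_i^H+\mathbf{\Sigma}_i)\mathbf{F}_i^H\big\}\le P_i,\quad i\in\{1,\dots,L\},$$ in the variables $\mathbf{F}_i\in\mathbb{C}^{N_i\times J_i}$, $i=1,\dots,L$, is a convex optimization problem with respect to $\{\mathbf{F}_i\}_{i=1}^L$; that is, the objective is a convex function of $(\mathbf{F}_1,\dots,\mathbf{F}_L)$ and each constraint function is a convex function of $(\mathbf{F}_1,\dots,\mathbf{F}_L)$.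
   Context: Positive integers $L,M,K$ and $N_i,J_i$ ($i=1,\dots,L$) are given, together with complex matrices $\mathbf{K}_i\in\mathbb{C}^{J_i\times K}$, $\mathbf{H}_i\in\mathbb{C}^{M\times N_i}$, Hermitian positive semidefinite (covariance) matrices $\mathbf{\Sigma}_{\mathbf{s}}\in\mathbb{C}^{K\times K}$ and $\mathbf{\Sigma}_i\in\mathbb{C}^{J_i\times J_i}$, and reals $\sigma_0^2>0$, $P_i>0$. For $\mathbf{F}_i\in\mathbb{C}^{N_i\times J_i}$ and $\mathbf{G}\in\mathbb{C}^{M\times K}$ put $\mathbf{S}=\sum_{i=1}^L\mathbf{H}_i\mathbf{F}_i\mathbf{K}_i$ and $$\mathsf{MSE}\big(\{\mathbf{F}_i\}_{i=1}^L,\mathbf{G}\big)=\mathrm{Tr}\Big\{\mathbf{G}^H\mathbf{S}\mathbf{\Sigma}_{\mathbf{s}}\mathbf{S}^H\mathbf{G}-\mathbf{G}^H\mathbf{S}\mathbf{\Sigma}_{\mathbf{s}}-\mathbf{\Sigma}_{\mathbf{s}}\mathbf{S}^H\mathbf{G}+\sum_{i=1}^L\mathbf{G}^H\mathbf{H}_i\mathbf{F}_i\mathbf{\Sigma}_i\mathbf{F}_i^H\mathbf{H}_i^H\mathbf{G}+\sigma_0^2\mathbf{G}^H\mathbf{G}+\mathbf{\Sigma}_{\mathbf{s}}\Big\},$$ which is real-valued. Here $^H$ is conjugate transpose. Convexity is understood over the real vector space underlying $\prod_i\mathbb{C}^{N_i\times J_i}$. *)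

theory Defs
  imports Complex_Main "Jordan_Normal_Form.Schur_Decomposition" "HOL-Library.FuncSet"
begin

text \<open>The sizes of the matrices vary with an index inside the statement, so matrices are taken
  from Jordan_Normal_Form, where dimensions are values and not types.
  \<^const>\<open>mat_adjoint\<close> is the conjugate transpose.\<close>

definition trace_mat :: "'a::comm_monoid_add mat \<Rightarrow> 'a" where
  "trace_mat A = (\<Sum>i<dim_row A. A $$ (i, i))"

text \<open>Matrices of all sizes share one type, which therefore has no zero; a sum over an
  index set needs the size of the result.\<close>

definition msum :: "nat \<Rightarrow> nat \<Rightarrow> ('i \<Rightarrow> 'a::comm_monoid_add mat) \<Rightarrow> 'i set \<Rightarrow> 'a mat" where
  "msum nr nc A I = mat nr nc (\<lambda>rc. \<Sum>i\<in>I. A i $$ rc)"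

text \<open>\<^term>\<open>(A *\<^sub>v x) \<bullet>c x\<close> is $x^H A x$, and \<open>0 \<le> z\<close> for complex \<open>z\<close> says that \<open>z\<close> is
  real and nonnegative.\<close>

definition hermitian_psd :: "nat \<Rightarrow> complex mat \<Rightarrow> bool" where
  "hermitian_psd n A \<longleftrightarrow> A \<in> carrier_mat n n \<and> mat_adjoint A = A \<and>
     (\<forall>x\<in>carrier_vec n. 0 \<le> (A *\<^sub>v x) \<bullet>c x)"


subsection \<open>Convexity on a product of matrix spaces\<close>

definition mat_families :: "'i set \<Rightarrow> ('i \<Rightarrow> nat) \<Rightarrow> ('i \<Rightarrow> nat) \<Rightarrow> ('i \<Rightarrow> complex mat) set" where
  "mat_families I nr nc = (\<Pi>\<^sub>E i\<in>I. carrier_mat (nr i) (nc i))"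

definition fam_comb ::
  "'i set \<Rightarrow> real \<Rightarrow> ('i \<Rightarrow> complex mat) \<Rightarrow> real \<Rightarrow> ('i \<Rightarrow> complex mat) \<Rightarrow> 'i \<Rightarrow> complex mat" where
  "fam_comb I u X v Y =
     (\<lambda>i\<in>I. complex_of_real u \<cdot>\<^sub>m X i + complex_of_real v \<cdot>\<^sub>m Y i)"

text \<open>The same definitions as \<open>convex\<close> and \<open>convex_on\<close> of HOL-Analysis, which do
  not apply here because the type of matrices is not an instance of \<^class>\<open>real_vector\<close>.\<close>

definition fam_convex :: "'i set \<Rightarrow> ('i \<Rightarrow> complex mat) set \<Rightarrow> bool" where
  "fam_convex I D \<longleftrightarrow>
     (\<forall>X\<in>D. \<forall>Y\<in>D. \<forall>u\<ge>0. \<forall>v\<ge>0. u + v = 1 \<longrightarrow> fam_comb I u X v Y \<in> D)"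

definition fam_convex_on ::
  "'i set \<Rightarrow> ('i \<Rightarrow> complex mat) set \<Rightarrow> (('i \<Rightarrow> complex mat) \<Rightarrow> real) \<Rightarrow> bool" where
  "fam_convex_on I D f \<longleftrightarrow> fam_convex I D \<and>
     (\<forall>X\<in>D. \<forall>Y\<in>D. \<forall>u\<ge>0. \<forall>v\<ge>0. u + v = 1 \<longrightarrow>
        f (fam_comb I u X v Y) \<le> u * f X + v * f Y)"

text \<open>The problem of minimizing \<open>f X\<close> over \<open>X \<in> D\<close> subject to \<open>g c X \<le> 0\<close> for all
  \<open>c \<in> C\<close>.\<close>

definition convex_optimization_problem ::
  "'i set \<Rightarrow> ('i \<Rightarrow> complex mat) set \<Rightarrow> (('i \<Rightarrow> complex mat) \<Rightarrow> real) \<Rightarrow>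
   'c set \<Rightarrow> ('c \<Rightarrow> ('i \<Rightarrow> complex mat) \<Rightarrow> real) \<Rightarrow> bool" where
  "convex_optimization_problem I D f C g \<longleftrightarrow>
     fam_convex_on I D f \<and> (\<forall>c\<in>C. fam_convex_on I D (g c))"


subsection \<open>Mean squared error and transmit power\<close>

definition signal_mat ::
  "nat \<Rightarrow> nat \<Rightarrow> nat \<Rightarrow> (nat \<Rightarrow> complex mat) \<Rightarrow> (nat \<Rightarrow> complex mat) \<Rightarrow> (nat \<Rightarrow> complex mat) \<Rightarrow>
   complex mat" where
  "signal_mat L M K H Kc F = msum M K (\<lambda>i. H i * F i * Kc i) {1..L}"

definition mse_trace ::
  "nat \<Rightarrow> nat \<Rightarrow> nat \<Rightarrow> (nat \<Rightarrow> complex mat) \<Rightarrow> (nat \<Rightarrow> complex mat) \<Rightarrow> complex mat \<Rightarrow>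
   (nat \<Rightarrow> complex mat) \<Rightarrow> real \<Rightarrow> (nat \<Rightarrow> complex mat) \<Rightarrow> complex mat \<Rightarrow> complex" where
  "mse_trace L M K H Kc \<Sigma>s \<Sigma> \<sigma>0sq F G =
     (let S = signal_mat L M K H Kc F in
      trace_mat
        (mat_adjoint G * S * \<Sigma>s * mat_adjoint S * G
         - mat_adjoint G * S * \<Sigma>s
         - \<Sigma>s * mat_adjoint S * G
         + msum K K (\<lambda>i. mat_adjoint G * H i * F i * \<Sigma> i * mat_adjoint (F i)
                          * mat_adjoint (H i) * G) {1..L}
         + complex_of_real \<sigma>0sq \<cdot>\<^sub>m (mat_adjoint G * G)
         + \<Sigma>s))"

definition power_trace ::
  "(nat \<Rightarrow> complex mat) \<Rightarrow> complex mat \<Rightarrow> (nat \<Rightarrow> complex mat) \<Rightarrow> nat \<Rightarrow>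
   (nat \<Rightarrow> complex mat) \<Rightarrow> complex" where
  "power_trace Kc \<Sigma>s \<Sigma> i F =
     trace_mat (F i * (Kc i * \<Sigma>s * mat_adjoint (Kc i) + \<Sigma> i) * mat_adjoint (F i))"

text \<open>Both traces are real for Hermitian covariances (\<open>mse_trace_real\<close> and
  \<open>power_trace_real\<close> below), so that taking the real part loses nothing.\<close>

definition mse ::
  "nat \<Rightarrow> nat \<Rightarrow> nat \<Rightarrow> (nat \<Rightarrow> complex mat) \<Rightarrow> (nat \<Rightarrow> complex mat) \<Rightarrow> complex mat \<Rightarrow>
   (nat \<Rightarrow> complex mat) \<Rightarrow> real \<Rightarrow> (nat \<Rightarrow> complex mat) \<Rightarrow> complex mat \<Rightarrow> real" where
  "mse L M K H Kc \<Sigma>s \<Sigma> \<sigma>0sq F G = Re (mse_trace L M K H Kc \<Sigma>s \<Sigma> \<sigma>0sq F G)"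

definition tx_power ::
  "(nat \<Rightarrow> complex mat) \<Rightarrow> complex mat \<Rightarrow> (nat \<Rightarrow> complex mat) \<Rightarrow> nat \<Rightarrow>
   (nat \<Rightarrow> complex mat) \<Rightarrow> real" where
  "tx_power Kc \<Sigma>s \<Sigma> i F = Re (power_trace Kc \<Sigma>s \<Sigma> i F)"


subsection \<open>The traces are real\<close>

lemma dim_mat_adjoint [simp]:
  "dim_row (mat_adjoint A) = dim_col A" "dim_col (mat_adjoint A) = dim_row A"
  by (simp_all add: mat_adjoint_def)

lemma mat_adjoint_carrier [simp]:
  "A \<in> carrier_mat n m \<Longrightarrow> mat_adjoint A \<in> carrier_mat m n"
  by (metis carrier_matD carrier_matI dim_mat_adjoint)

lemma mat_adjoint_index [simp]:
  assumes "i < dim_col A" "j < dim_row A"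
  shows "mat_adjoint A $$ (i, j) = conjugate (A $$ (j, i))"
  unfolding mat_adjoint_def using assms by (simp add: mat_of_rows_index)

lemma mat_adjoint_mult:
  fixes A B :: "complex mat"
  assumes "dim_col A = dim_row B"
  shows "mat_adjoint (A * B) = mat_adjoint B * mat_adjoint A"
proof (rule eq_matI)
  fix i j
  assume ij: "i < dim_row (mat_adjoint B * mat_adjoint A)" "j < dim_col (mat_adjoint B * mat_adjoint A)"
  have "mat_adjoint (A * B) $$ (i, j) = cnj (\<Sum>k<dim_row B. A $$ (j, k) * B $$ (k, i))"
    using ij assms by (simp add: scalar_prod_def atLeast0LessThan)
  also have "\<dots> = (\<Sum>k<dim_row B. cnj (B $$ (k, i)) * cnj (A $$ (j, k)))"
    by (simp add: mult.commute)
  also have "\<dots> = (mat_adjoint B * mat_adjoint A) $$ (i, j)"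
    using ij assms by (simp add: scalar_prod_def atLeast0LessThan)
  finally show "mat_adjoint (A * B) $$ (i, j) = (mat_adjoint B * mat_adjoint A) $$ (i, j)" .
qed (use assms in simp_all)

lemma mat_adjoint_add:
  fixes A B :: "complex mat"
  assumes "dim_row A = dim_row B" "dim_col A = dim_col B"
  shows "mat_adjoint (A + B) = mat_adjoint A + mat_adjoint B"
  by (rule eq_matI) (use assms in auto)

lemma mat_adjoint_adjoint [simp]: "mat_adjoint (mat_adjoint A) = (A :: complex mat)"
  by (rule eq_matI) auto

lemma trace_mat_adjoint:
  "A \<in> carrier_mat n n \<Longrightarrow> trace_mat (mat_adjoint A) = cnj (trace_mat A)"
  by (auto simp: trace_mat_def)

lemma trace_mat_hermitian_real:
  fixes A :: "complex mat"
  assumes "A \<in> carrier_mat n n" "mat_adjoint A = A"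
  shows "trace_mat A \<in> \<real>"
  using trace_mat_adjoint[OF assms(1)] assms(2) by (simp add: Reals_cnj_iff)

lemma mat_adjoint_sandwich:
  fixes A B :: "complex mat"
  assumes A: "A \<in> carrier_mat n m" and B: "B \<in> carrier_mat m m" "mat_adjoint B = B"
  shows "mat_adjoint (A * B * mat_adjoint A) = A * B * mat_adjoint A"
proof -
  have "mat_adjoint (A * B * mat_adjoint A) = A * (B * mat_adjoint A)"
    using carrier_matD[OF A] carrier_matD[OF B(1)] B(2) by (simp add: mat_adjoint_mult)
  also have "\<dots> = A * B * mat_adjoint A"
    by (rule assoc_mult_mat[symmetric, OF A B(1) mat_adjoint_carrier[OF A]])
  finally show ?thesis .
qed

lemma trace_mat_add:
  "A \<in> carrier_mat n n \<Longrightarrow> B \<in> carrier_mat n n \<Longrightarrow>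
     trace_mat (A + B) = trace_mat A + (trace_mat B :: complex)"
  by (auto simp: trace_mat_def sum.distrib)

lemma trace_mat_minus:
  "A \<in> carrier_mat n n \<Longrightarrow> B \<in> carrier_mat n n \<Longrightarrow>
     trace_mat (A - B) = trace_mat A - (trace_mat B :: complex)"
  by (auto simp: trace_mat_def sum_subtractf)

lemma trace_mat_smult:
  "A \<in> carrier_mat n n \<Longrightarrow> trace_mat (c \<cdot>\<^sub>m A) = c * (trace_mat A :: complex)"
  by (auto simp: trace_mat_def sum_distrib_left)

lemma msum_carrier [simp]: "msum n m A I \<in> carrier_mat n m"
  by (simp add: msum_def)

lemma trace_mat_msum:
  assumes "\<And>i. i \<in> I \<Longrightarrow> A i \<in> carrier_mat n n"
  shows "trace_mat (msum n n A I) = (\<Sum>i\<in>I. trace_mat (A i) :: complex)"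
proof -
  have "trace_mat (msum n n A I) = (\<Sum>k<n. \<Sum>i\<in>I. A i $$ (k, k))"
    by (simp add: trace_mat_def msum_def)
  also have "\<dots> = (\<Sum>i\<in>I. \<Sum>k<n. A i $$ (k, k))"
    by (rule sum.swap)
  also have "\<dots> = (\<Sum>i\<in>I. trace_mat (A i))"
    using assms by (intro sum.cong) (auto simp: trace_mat_def)
  finally show ?thesis .
qed

lemma power_trace_real:
  assumes F: "F i \<in> carrier_mat n j" and Kc: "Kc i \<in> carrier_mat j k"
    and "hermitian_psd k \<Sigma>s" "hermitian_psd j (\<Sigma> i)"
  shows "power_trace Kc \<Sigma>s \<Sigma> i F \<in> \<real>"
proof -
  have s: "\<Sigma>s \<in> carrier_mat k k" "mat_adjoint \<Sigma>s = \<Sigma>s"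
    and n: "\<Sigma> i \<in> carrier_mat j j" "mat_adjoint (\<Sigma> i) = \<Sigma> i"
    using assms by (auto simp: hermitian_psd_def)
  let ?R = "Kc i * \<Sigma>s * mat_adjoint (Kc i) + \<Sigma> i"
  have R: "?R \<in> carrier_mat j j"
    using Kc s n by auto
  have "mat_adjoint ?R = ?R"
    using n carrier_matD[OF Kc] carrier_matD[OF n(1)]
    by (simp add: mat_adjoint_add mat_adjoint_sandwich[OF Kc s])
  from mat_adjoint_sandwich[OF F R this] show ?thesis
    unfolding power_trace_def using F
    by (intro trace_mat_hermitian_real[where n = n]) auto
qed

lemma mse_trace_real:
  assumes H: "\<And>i. i \<in> {1..L} \<Longrightarrow> H i \<in> carrier_mat M (N i)"
    and F: "F \<in> mat_families {1..L} N J"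
    and "hermitian_psd K \<Sigma>s"
    and "\<And>i. i \<in> {1..L} \<Longrightarrow> hermitian_psd (J i) (\<Sigma> i)"
    and G: "G \<in> carrier_mat M K"
  shows "mse_trace L M K H Kc \<Sigma>s \<Sigma> \<sigma>0sq F G \<in> \<real>"
proof -
  have s: "\<Sigma>s \<in> carrier_mat K K" "mat_adjoint \<Sigma>s = \<Sigma>s"
    and n: "\<And>i. i \<in> {1..L} \<Longrightarrow> \<Sigma> i \<in> carrier_mat (J i) (J i)"
      "\<And>i. i \<in> {1..L} \<Longrightarrow> mat_adjoint (\<Sigma> i) = \<Sigma> i"
    using assms by (auto simp: hermitian_psd_def)
  have Fi: "F i \<in> carrier_mat (N i) (J i)" if "i \<in> {1..L}" for i
    using F that by (auto simp: mat_families_def)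
  define S where "S = signal_mat L M K H Kc F"
  define T1 where "T1 = mat_adjoint G * S * \<Sigma>s * mat_adjoint S * G"
  define T2 where "T2 = mat_adjoint G * S * \<Sigma>s"
  define T3 where "T3 = \<Sigma>s * mat_adjoint S * G"
  define T4 where "T4 = (\<lambda>i. mat_adjoint G * H i * F i * \<Sigma> i * mat_adjoint (F i)
                          * mat_adjoint (H i) * G)"
  define T5 where "T5 = mat_adjoint G * G"
  note GA = mat_adjoint_carrier[OF G]
  note dims = carrier_matD[OF G] carrier_matD[OF s(1)]
  have S: "S \<in> carrier_mat M K"
    by (simp add: S_def signal_mat_def)
  note SA = mat_adjoint_carrier[OF S]
  note dims = dims carrier_matD[OF S]
  have GS: "mat_adjoint G * S \<in> carrier_mat K K"
    using GA S by auto
  have C: "T1 \<in> carrier_mat K K" "T2 \<in> carrier_mat K K" "T3 \<in> carrier_mat K K"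
    "T5 \<in> carrier_mat K K"
    using G GA S SA s by (auto simp: T1_def T2_def T3_def T5_def)
  have "mat_adjoint (mat_adjoint G * S) = mat_adjoint S * G"
    using dims by (simp add: mat_adjoint_mult)
  then have "T1 = mat_adjoint G * S * \<Sigma>s * mat_adjoint (mat_adjoint G * S)"
    unfolding T1_def using assoc_mult_mat[OF mult_carrier_mat[OF GS s(1)] SA G] by simp
  with mat_adjoint_sandwich[OF GS s] have "mat_adjoint T1 = T1"
    by simp
  with C have R1: "trace_mat T1 \<in> \<real>"
    by (blast intro: trace_mat_hermitian_real)
  have "T3 = mat_adjoint T2"
    unfolding T2_def T3_def using dims s(2) assoc_mult_mat[OF s(1) SA G]
    by (simp add: mat_adjoint_mult)
  with C have "trace_mat T2 + trace_mat T3 = trace_mat T2 + cnj (trace_mat T2)"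
    by (simp add: trace_mat_adjoint)
  then have R23: "trace_mat T2 + trace_mat T3 \<in> \<real>"
    by (simp add: complex_is_Real_iff)
  have R4: "T4 i \<in> carrier_mat K K" "trace_mat (T4 i) \<in> \<real>" if i: "i \<in> {1..L}" for i
  proof -
    define B where "B = mat_adjoint G * H i * F i"
    note c = H[OF i] Fi[OF i] n(1)[OF i]
    note ca = mat_adjoint_carrier[OF c(1)] mat_adjoint_carrier[OF c(2)]
    have B: "B \<in> carrier_mat K (J i)"
      using GA c by (auto simp: B_def)
    have "mat_adjoint B = mat_adjoint (F i) * (mat_adjoint (H i) * G)"
      using dims carrier_matD[OF c(1)] carrier_matD[OF c(2)]
      by (simp add: B_def mat_adjoint_mult)
    moreover have "T4 i = B * \<Sigma> i * (mat_adjoint (F i) * (mat_adjoint (H i) * G))"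
    proof -
      have X: "B * \<Sigma> i \<in> carrier_mat K (J i)" using B c by auto
      have Y: "mat_adjoint (H i) * G \<in> carrier_mat (N i) K" using ca G by auto
      have "T4 i = B * \<Sigma> i * mat_adjoint (F i) * mat_adjoint (H i) * G"
        by (simp add: T4_def B_def)
      also have "\<dots> = B * \<Sigma> i * mat_adjoint (F i) * (mat_adjoint (H i) * G)"
        by (rule assoc_mult_mat[OF mult_carrier_mat[OF X ca(2)] ca(1) G])
      also have "\<dots> = B * \<Sigma> i * (mat_adjoint (F i) * (mat_adjoint (H i) * G))"
        by (rule assoc_mult_mat[OF X ca(2) Y])
      finally show ?thesis .
    qed
    ultimately have T: "T4 i = B * \<Sigma> i * mat_adjoint B"
      by simp
    then show C4: "T4 i \<in> carrier_mat K K"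
      using B c by auto
    show "trace_mat (T4 i) \<in> \<real>"
      using trace_mat_hermitian_real[OF C4] mat_adjoint_sandwich[OF B n[OF i]] T by simp
  qed
  have R4sum: "trace_mat (msum K K T4 {1..L}) = (\<Sum>i\<in>{1..L}. trace_mat (T4 i))"
    by (rule trace_mat_msum) (rule R4(1))
  have "mat_adjoint T5 = T5"
    using dims by (simp add: T5_def mat_adjoint_mult)
  with C have R5: "trace_mat T5 \<in> \<real>"
    by (blast intro: trace_mat_hermitian_real)
  have Rs: "trace_mat \<Sigma>s \<in> \<real>"
    using s by (blast intro: trace_mat_hermitian_real)
  have "mse_trace L M K H Kc \<Sigma>s \<Sigma> \<sigma>0sq F G
      = trace_mat (T1 - T2 - T3 + msum K K T4 {1..L} + complex_of_real \<sigma>0sq \<cdot>\<^sub>m T5 + \<Sigma>s)"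
    by (simp add: mse_trace_def Let_def S_def T1_def T2_def T3_def T4_def T5_def)
  also have "\<dots> = trace_mat T1 - trace_mat T2 - trace_mat T3 + (\<Sum>i\<in>{1..L}. trace_mat (T4 i))
      + complex_of_real \<sigma>0sq * trace_mat T5 + trace_mat \<Sigma>s"
    using C s R4(1)
    by (simp add: trace_mat_add[of _ K] trace_mat_minus[of _ K] trace_mat_smult[of _ K]
        minus_carrier_mat R4sum del: One_nat_def)
  also have "\<dots> = trace_mat T1 - (trace_mat T2 + trace_mat T3) + (\<Sum>i\<in>{1..L}. trace_mat (T4 i))
      + complex_of_real \<sigma>0sq * trace_mat T5 + trace_mat \<Sigma>s"
    by simp
  also have "\<dots> \<in> \<real>"
    by (intro Reals_add Reals_diff Reals_mult sum_in_Reals R1 R23 R4(2) R5 Rs Reals_of_real)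
  finally show ?thesis .
qed

end

theory Submission
  imports Defs
begin

text \<open>For positive semidefinite \<open>R\<close> the function \<open>q A = Tr (A R A\<^sup>H)\<close> is a nonnegative quadratic
  form, and \<open>u q(A) + v q(B) - q(u A + v B) = u v q(A - B)\<close> whenever \<open>u + v = 1\<close>; hence it is
  convex.  With \<open>G\<close> fixed, the error is a sum of such forms evaluated at the linear images
  \<open>G\<^sup>H S\<close> and \<open>G\<^sup>H H\<^sub>i F\<^sub>i\<close> of the precoders, the linear term \<open>- 2 Re Tr (G\<^sup>H S \<Sigma>s)\<close> and
  a constant.\<close>

section \<open>Real combinations of matrices and the linear maps that commute with them\<close>

text \<open>This is one component of \<open>fam_comb\<close>. Once it has a name, linearity of a map
  becomes a rewrite rule that moves \<open>mat_comb\<close> outward through products, traces and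
  sums.\<close>

definition mat_comb :: "real \<Rightarrow> complex mat \<Rightarrow> real \<Rightarrow> complex mat \<Rightarrow> complex mat" where
  "mat_comb u A v B = complex_of_real u \<cdot>\<^sub>m A + complex_of_real v \<cdot>\<^sub>m B"

text \<open>The total of the forms x^H R x over the conjugated rows x of \<open>A\<close>. For
  Hermitian \<open>R\<close> of matching size the trace is real, so \<open>Re\<close> only changes
  the type.\<close>

definition quad_trace :: "complex mat \<Rightarrow> complex mat \<Rightarrow> real" where
  "quad_trace R A = Re (trace_mat (A * R * mat_adjoint A))"

lemma mat_comb_carrier [simp]:
  "A \<in> carrier_mat n m \<Longrightarrow> B \<in> carrier_mat n m \<Longrightarrow> mat_comb u A v B \<in> carrier_mat n m"
  by (simp add: mat_comb_def)

lemma mat_comb_index: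
  assumes "A \<in> carrier_mat n m" "B \<in> carrier_mat n m" "i < n" "j < m"
  shows "mat_comb u A v B $$ (i, j)
    = complex_of_real u * A $$ (i, j) + complex_of_real v * B $$ (i, j)"
  using assms by (simp add: mat_comb_def)

lemma mult_mat_comb_left:
  assumes "A \<in> carrier_mat n m" "B \<in> carrier_mat n m" "D \<in> carrier_mat m k"
  shows "mat_comb u A v B * D = mat_comb u (A * D) v (B * D)"
  unfolding mat_comb_def using assms
  by (simp add: add_mult_distrib_mat[of _ n m] mult_smult_assoc_mat[of _ n m _ k])

lemma mult_mat_comb_right:
  assumes "A \<in> carrier_mat n m" "B \<in> carrier_mat n m" "D \<in> carrier_mat k n"
  shows "D * mat_comb u A v B = mat_comb u (D * A) v (D * B)"
  unfolding mat_comb_def using assms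
  by (simp add: mult_add_distrib_mat[of D k n _ m] mult_smult_distrib[of D k n _ m])

lemma trace_mat_comb:
  assumes "A \<in> carrier_mat n n" "B \<in> carrier_mat n n"
  shows "trace_mat (mat_comb u A v B)
    = complex_of_real u * trace_mat A + complex_of_real v * trace_mat B"
  unfolding mat_comb_def using assms
  by (simp add: trace_mat_add[of _ n] trace_mat_smult[of _ n])

lemma msum_mat_comb:
  assumes "\<And>i. i \<in> I \<Longrightarrow> A i \<in> carrier_mat n m" "\<And>i. i \<in> I \<Longrightarrow> B i \<in> carrier_mat n m"
  shows "msum n m (\<lambda>i. mat_comb u (A i) v (B i)) I = mat_comb u (msum n m A I) v (msum n m B I)"
proof (rule eq_matI)
  fix r c
  assume "r < dim_row (mat_comb u (msum n m A I) v (msum n m B I))"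
    and "c < dim_col (mat_comb u (msum n m A I) v (msum n m B I))"
  then have rc: "r < n" "c < m" by (auto simp: mat_comb_def msum_def)
  have "(\<Sum>i\<in>I. mat_comb u (A i) v (B i) $$ (r, c))
      = (\<Sum>i\<in>I. complex_of_real u * A i $$ (r, c) + complex_of_real v * B i $$ (r, c))"
    by (intro sum.cong refl mat_comb_index[of _ n m] assms rc)
  then show "msum n m (\<lambda>i. mat_comb u (A i) v (B i)) I $$ (r, c)
      = mat_comb u (msum n m A I) v (msum n m B I) $$ (r, c)"
    using rc by (simp add: mat_comb_def msum_def sum.distrib sum_distrib_left)
qed (auto simp: mat_comb_def msum_def)

text \<open>The domain is a full product of matrix spaces, hence closed under all real combinations
  and in particular convex. Since \<open>fam_comb\<close> is \<open>undefined\<close> outside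
  \<open>I\<close>, the result is extensional, as \<open>mat_families\<close> demands.\<close>

lemma fam_comb_in_mat_families:
  assumes "X \<in> mat_families I n m" "Y \<in> mat_families I n m"
  shows "fam_comb I u X v Y \<in> mat_families I n m"
  using assms by (auto simp: mat_families_def fam_comb_def PiE_iff)

lemma fam_comb_apply: "i \<in> I \<Longrightarrow> fam_comb I u X v Y i = mat_comb u (X i) v (Y i)"
  by (simp add: fam_comb_def mat_comb_def)

text \<open>Each summand multiplies one precoder by fixed matrices on the left and on the right, so
  the signal matrix is linear in the family.\<close>

lemma signal_mat_fam_comb:
  assumes H: "\<And>i. i \<in> {1..L} \<Longrightarrow> H i \<in> carrier_mat M (N i)"
    and Kc: "\<And>i. i \<in> {1..L} \<Longrightarrow> Kc i \<in> carrier_mat (J i) K"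
    and X: "\<And>i. i \<in> {1..L} \<Longrightarrow> X i \<in> carrier_mat (N i) (J i)"
    and Y: "\<And>i. i \<in> {1..L} \<Longrightarrow> Y i \<in> carrier_mat (N i) (J i)"
  shows "signal_mat L M K H Kc (fam_comb {1..L} u X v Y)
    = mat_comb u (signal_mat L M K H Kc X) v (signal_mat L M K H Kc Y)"
proof -
  have "H i * fam_comb {1..L} u X v Y i * Kc i
      = mat_comb u (H i * X i * Kc i) v (H i * Y i * Kc i)" if i: "i \<in> {1..L}" for i
    unfolding fam_comb_apply[OF i] mult_mat_comb_right[OF X[OF i] Y[OF i] H[OF i]]
    by (rule mult_mat_comb_left[OF mult_carrier_mat[OF H X] mult_carrier_mat[OF H Y] Kc]) (rule i)+
  then have "signal_mat L M K H Kc (fam_comb {1..L} u X v Y)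
      = msum M K (\<lambda>i. mat_comb u (H i * X i * Kc i) v (H i * Y i * Kc i)) {1..L}"
    \<comment> \<open>The summands are known to agree only on the index set, so the replacement
      takes place inside the entrywise sums that define \<open>msum\<close>.\<close>
    unfolding signal_mat_def msum_def by (intro cong_mat refl sum.cong) simp
  also have "\<dots> = mat_comb u (signal_mat L M K H Kc X) v (signal_mat L M K H Kc Y)"
    unfolding signal_mat_def
    by (rule msum_mat_comb) (use H X Y Kc in \<open>blast intro: mult_carrier_mat\<close>)+
  finally show ?thesis .
qed

section \<open>The quadratic form Tr (A R A^H)\<close>

text \<open>Entrywise form from which both the nonnegativity and the convexity gap of
  \<open>quad_trace\<close> are read off. The sum over \<open>l\<close> is outside the one over
  \<open>k\<close> because \<open>A * R\<close> is formed first.\<close>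

lemma trace_mat_sandwich:
  assumes A: "A \<in> carrier_mat n m" and R: "R \<in> carrier_mat m m"
  shows "trace_mat (A * R * mat_adjoint A)
    = (\<Sum>i<n. \<Sum>l<m. \<Sum>k<m. A $$ (i, k) * R $$ (k, l) * cnj (A $$ (i, l)))"
  using carrier_matD[OF A] carrier_matD[OF R]
  by (simp add: trace_mat_def scalar_prod_def atLeast0LessThan sum_distrib_right)

text \<open>The diagonal entry of A R A^H at i is the form of \<open>R\<close> at the conjugate of
  row i of \<open>A\<close>; the trace adds up these nonnegative values.\<close>

lemma quad_trace_nonneg:
  assumes A: "A \<in> carrier_mat n m" and "hermitian_psd m R"
  shows "0 \<le> quad_trace R A"
proof -
  have R: "R \<in> carrier_mat m m" and psd: "\<And>x. x \<in> carrier_vec m \<Longrightarrow> 0 \<le> (R *\<^sub>v x) \<bullet>c x"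
    using assms by (auto simp: hermitian_psd_def)
  have row: "0 \<le> (\<Sum>l<m. \<Sum>k<m. A $$ (i, k) * R $$ (k, l) * cnj (A $$ (i, l)))" for i
  proof -
    \<comment> \<open>The row is conjugated because \<open>\<bullet>c\<close> conjugates its second
      argument: that factor becomes \<open>A $$ (i, k)\<close> again, while the factor inside
      \<open>R *\<^sub>v x\<close> supplies \<open>cnj (A $$ (i, l))\<close>.\<close>
    define x where "x = vec m (\<lambda>l. cnj (A $$ (i, l)))"
    have "(R *\<^sub>v x) \<bullet>c x = (\<Sum>k<m. \<Sum>l<m. A $$ (i, k) * R $$ (k, l) * cnj (A $$ (i, l)))"
      using carrier_matD[OF R]
      by (simp add: x_def scalar_prod_def atLeast0LessThan sum_distrib_left mult_ac)
    also have "\<dots> = (\<Sum>l<m. \<Sum>k<m. A $$ (i, k) * R $$ (k, l) * cnj (A $$ (i, l)))"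
      by (rule sum.swap)
    finally show ?thesis using psd[of x] by (simp add: x_def)
  qed
  have "0 \<le> trace_mat (A * R * mat_adjoint A)"
    unfolding trace_mat_sandwich[OF A R] by (rule sum_nonneg) (rule row)
  then show ?thesis by (simp add: quad_trace_def less_eq_complex_def)
qed

text \<open>The exact gap in the convexity inequality. On expansion the pure terms have weights u -
  u^2 and v - v^2, both equal to u v, and the mixed terms have weight - u v.\<close>

lemma quad_trace_mat_comb:
  assumes A: "A \<in> carrier_mat n m" and B: "B \<in> carrier_mat n m" and R: "R \<in> carrier_mat m m"
    and uv: "u + v = 1"
  shows "u * quad_trace R A + v * quad_trace R B - quad_trace R (mat_comb u A v B)
    = u * v * quad_trace R (A - B)"
proof -
  have v: "v = 1 - u" using uv by simp
  have D: "A - B \<in> carrier_mat n m" using B by (rule minus_carrier_mat)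
  \<comment> \<open>\<open>a\<close> and \<open>b\<close> stand for entries in column
    \<open>k\<close>, \<open>a'\<close> and \<open>b'\<close> for entries of the same row in column
    \<open>l\<close>. The conjugates act as independent variables, so this is a polynomial identity
    once \<open>v\<close> is \<open>1 - u\<close>.\<close>
  have ent: "u * (a * r * cnj a') + v * (b * r * cnj b')
        - (u * a + v * b) * r * (u * cnj a' + v * cnj b')
      = u * v * ((a - b) * r * (cnj a' - cnj b'))" for a b a' b' r :: complex
    by (simp add: v algebra_simps)
  have "u * trace_mat (A * R * mat_adjoint A) + v * trace_mat (B * R * mat_adjoint B)
      - trace_mat (mat_comb u A v B * R * mat_adjoint (mat_comb u A v B))
    = u * v * trace_mat ((A - B) * R * mat_adjoint (A - B))"
    \<comment> \<open>All the triple sums have the same ranges, so each side merges into a single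
      one and \<open>ent\<close> applies summand by summand.\<close>
    unfolding trace_mat_sandwich[OF A R] trace_mat_sandwich[OF B R] trace_mat_sandwich[OF D R]
      trace_mat_sandwich[OF mat_comb_carrier[OF A B] R] sum_distrib_left
      sum.distrib[symmetric] sum_subtractf[symmetric]
    using A B by (intro sum.cong refl) (simp add: mat_comb_index[of _ n m] ent)
  from arg_cong[OF this, of Re] show ?thesis
    by (simp add: quad_trace_def)
qed

text \<open>The gap u v q(A - B) is a product of nonnegative factors.\<close>

lemma quad_trace_convex:
  assumes "A \<in> carrier_mat n m" "B \<in> carrier_mat n m" and R: "hermitian_psd m R"
    and uv: "0 \<le> u" "0 \<le> v" "u + v = 1"
  shows "quad_trace R (mat_comb u A v B) \<le> u * quad_trace R A + v * quad_trace R B"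
proof -
  have "0 \<le> u * v * quad_trace R (A - B)"
    using uv quad_trace_nonneg[OF minus_carrier_mat[OF assms(2)] R] by simp
  then show ?thesis
    using quad_trace_mat_comb[OF assms(1,2) _ uv(3), of R] R by (simp add: hermitian_psd_def)
qed

section \<open>Positive semidefinite covariances and the power constraints\<close>

lemma hermitian_psd_add:
  assumes "hermitian_psd n A" "hermitian_psd n B"
  shows "hermitian_psd n (A + B)"
proof -
  have c: "A \<in> carrier_mat n n" "B \<in> carrier_mat n n"
    using assms by (auto simp: hermitian_psd_def)
  have "((A + B) *\<^sub>v x) \<bullet>c x = (A *\<^sub>v x) \<bullet>c x + (B *\<^sub>v x) \<bullet>c x" if "x \<in> carrier_vec n" for x
    using c that by (simp add: add_mult_distrib_mat_vec[of _ n n] add_scalar_prod_distrib[of _ n])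
  moreover have "mat_adjoint (A + B) = mat_adjoint A + mat_adjoint B"
    using c by (intro mat_adjoint_add) auto
  ultimately show ?thesis
    using assms c by (simp add: hermitian_psd_def)
qed

text \<open>With y = A^H x, the form of the product at x equals the form of \<open>R\<close> at y.
  It is applied to the covariance of the source seen through \<open>Kc i\<close>.\<close>

lemma hermitian_psd_sandwich:
  assumes A: "A \<in> carrier_mat n m" and "hermitian_psd m R"
  shows "hermitian_psd n (A * R * mat_adjoint A)"
proof -
  have R: "R \<in> carrier_mat m m" "mat_adjoint R = R"
    and psd: "\<And>x. x \<in> carrier_vec m \<Longrightarrow> 0 \<le> (R *\<^sub>v x) \<bullet>c x"
    using assms(2) by (auto simp: hermitian_psd_def)
  note AH = mat_adjoint_carrier[OF A]
  have eq: "(A * R * mat_adjoint A *\<^sub>v x) \<bullet>c x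
      = (R *\<^sub>v (mat_adjoint A *\<^sub>v x)) \<bullet>c (mat_adjoint A *\<^sub>v x)" if x: "x \<in> carrier_vec n" for x
  proof -
    define y where "y = mat_adjoint A *\<^sub>v x"
    have y: "y \<in> carrier_vec m" and z: "R *\<^sub>v y \<in> carrier_vec m"
      using AH x R by (auto simp: y_def)
    have "A * R * mat_adjoint A *\<^sub>v x = A *\<^sub>v (R *\<^sub>v y)"
      unfolding assoc_mult_mat_vec[OF mult_carrier_mat[OF A R(1)] AH x] y_def[symmetric]
      by (rule assoc_mult_mat_vec[OF A R(1) y])
    also have "(A *\<^sub>v (R *\<^sub>v y)) \<bullet>c x = (R *\<^sub>v y) \<bullet>c y"
    proof -
      \<comment> \<open>The conjugate transpose is the adjoint for the inner product; exchanging two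
        finite sums shows it.\<close>
      have "(A *\<^sub>v w) \<bullet>c x = w \<bullet>c y" if w: "w \<in> carrier_vec m" for w
      proof -
        have "(A *\<^sub>v w) \<bullet>c x = (\<Sum>i<n. \<Sum>k<m. A $$ (i, k) * w $ k * cnj (x $ i))"
          using A x w by (auto simp: scalar_prod_def atLeast0LessThan sum_distrib_right)
        also have "\<dots> = (\<Sum>k<m. \<Sum>i<n. A $$ (i, k) * w $ k * cnj (x $ i))"
          by (rule sum.swap)
        also have "\<dots> = w \<bullet>c y"
          using A x w
          by (auto simp: y_def scalar_prod_def atLeast0LessThan sum_distrib_left mult_ac)
        finally show ?thesis .
      qed
      from this[OF z] show ?thesis .
    qed
    finally show ?thesis by (simp add: y_def)
  qed
  show ?thesis
    unfolding hermitian_psd_def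
  proof (intro conjI ballI)
    show "A * R * mat_adjoint A \<in> carrier_mat n n"
      by (rule mult_carrier_mat[OF mult_carrier_mat[OF A R(1)] AH])
    show "mat_adjoint (A * R * mat_adjoint A) = A * R * mat_adjoint A"
      by (rule mat_adjoint_sandwich[OF A R])
    show "0 \<le> (A * R * mat_adjoint A *\<^sub>v x) \<bullet>c x" if "x \<in> carrier_vec n" for x
      unfolding eq[OF that] by (rule psd[OF mult_mat_vec_carrier[OF AH that]])
  qed
qed

text \<open>The matrix between the two precoder factors is positive semidefinite by the closure
  lemmas, so the power is \<open>quad_trace\<close> at the single component
  \<open>F i\<close>.\<close>

lemma tx_power_convex:
  assumes i: "i \<in> I" and Kc: "Kc i \<in> carrier_mat (m i) k"
    and s: "hermitian_psd k \<Sigma>s" "hermitian_psd (m i) (\<Sigma> i)"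
  shows "fam_convex_on I (mat_families I n m) (\<lambda>F. tx_power Kc \<Sigma>s \<Sigma> i F - p)"
proof -
  let ?R = "Kc i * \<Sigma>s * mat_adjoint (Kc i) + \<Sigma> i"
  have R: "hermitian_psd (m i) ?R"
    by (intro hermitian_psd_add hermitian_psd_sandwich[OF Kc] s)
  have tx: "tx_power Kc \<Sigma>s \<Sigma> i F = quad_trace ?R (F i)" for F
    by (simp add: tx_power_def power_trace_def quad_trace_def)
  have "tx_power Kc \<Sigma>s \<Sigma> i (fam_comb I u X v Y) - p
      \<le> u * (tx_power Kc \<Sigma>s \<Sigma> i X - p) + v * (tx_power Kc \<Sigma>s \<Sigma> i Y - p)"
    if "X \<in> mat_families I n m" "Y \<in> mat_families I n m"
      and uv: "0 \<le> u" "0 \<le> v" "u + v = 1" for X Y u v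
  proof -
    have "X i \<in> carrier_mat (n i) (m i)" "Y i \<in> carrier_mat (n i) (m i)"
      using that i by (auto simp: mat_families_def)
    from quad_trace_convex[OF this R uv]
    have "tx_power Kc \<Sigma>s \<Sigma> i (fam_comb I u X v Y)
        \<le> u * tx_power Kc \<Sigma>s \<Sigma> i X + v * tx_power Kc \<Sigma>s \<Sigma> i Y"
      by (simp add: tx fam_comb_apply[OF i])
    \<comment> \<open>The constant passes through because the weights sum to 1.\<close>
    moreover have "u * p + v * p = p"
      using uv by (simp flip: distrib_right)
    ultimately show ?thesis by (simp add: right_diff_distrib)
  qed
  then show ?thesis
    by (simp add: fam_convex_on_def fam_convex_def fam_comb_in_mat_families)
qed

section \<open>The mean squared error as a function of the precoders\<close>

text \<open>Reassociating products exhibits the signal term and every noise term in the form B R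
  B^H, and the two cross terms are conjugate to each other. What remains does not contain the
  precoders.\<close>

lemma mse_eq_quad_trace:
  assumes H: "\<And>i. i \<in> {1..L} \<Longrightarrow> H i \<in> carrier_mat M (N i)"
    and F: "\<And>i. i \<in> {1..L} \<Longrightarrow> F i \<in> carrier_mat (N i) (J i)"
    and s: "\<Sigma>s \<in> carrier_mat K K" "mat_adjoint \<Sigma>s = \<Sigma>s"
    and n: "\<And>i. i \<in> {1..L} \<Longrightarrow> \<Sigma> i \<in> carrier_mat (J i) (J i)"
    and G: "G \<in> carrier_mat M K"
  shows "mse L M K H Kc \<Sigma>s \<Sigma> \<sigma>0sq F G
    = quad_trace \<Sigma>s (mat_adjoint G * signal_mat L M K H Kc F)
      - 2 * Re (trace_mat (mat_adjoint G * signal_mat L M K H Kc F * \<Sigma>s))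
      + (\<Sum>i\<in>{1..L}. quad_trace (\<Sigma> i) (mat_adjoint G * H i * F i))
      + \<sigma>0sq * Re (trace_mat (mat_adjoint G * G)) + Re (trace_mat \<Sigma>s)"
proof -
  define S where "S = signal_mat L M K H Kc F"
  define T1 where "T1 = mat_adjoint G * S * \<Sigma>s * mat_adjoint S * G"
  define T2 where "T2 = mat_adjoint G * S * \<Sigma>s"
  define T3 where "T3 = \<Sigma>s * mat_adjoint S * G"
  define T4 where "T4 = (\<lambda>i. mat_adjoint G * H i * F i * \<Sigma> i * mat_adjoint (F i)
                          * mat_adjoint (H i) * G)"
  define T5 where "T5 = mat_adjoint G * G"
  note GA = mat_adjoint_carrier[OF G]
  have S: "S \<in> carrier_mat M K"
    by (simp add: S_def signal_mat_def)
  note SA = mat_adjoint_carrier[OF S]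
  note dims = carrier_matD[OF G] carrier_matD[OF s(1)] carrier_matD[OF S]
  have GS: "mat_adjoint G * S \<in> carrier_mat K K"
    using GA S by auto
  have C: "T1 \<in> carrier_mat K K" "T2 \<in> carrier_mat K K" "T3 \<in> carrier_mat K K"
    "T5 \<in> carrier_mat K K"
    using G GA S SA s by (auto simp: T1_def T2_def T3_def T5_def)
  have "mat_adjoint (mat_adjoint G * S) = mat_adjoint S * G"
    using dims by (simp add: mat_adjoint_mult)
  then have "T1 = mat_adjoint G * S * \<Sigma>s * mat_adjoint (mat_adjoint G * S)"
    unfolding T1_def using assoc_mult_mat[OF mult_carrier_mat[OF GS s(1)] SA G] by simp
  then have R1: "Re (trace_mat T1) = quad_trace \<Sigma>s (mat_adjoint G * S)"
    by (simp add: quad_trace_def)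
  \<comment> \<open>Hermitian symmetry of \<open>\<Sigma>s\<close> makes one cross term the adjoint
    of the other, which gives the factor 2 in front of the real part.\<close>
  have "T3 = mat_adjoint T2"
    unfolding T2_def T3_def using dims s(2) assoc_mult_mat[OF s(1) SA G]
    by (simp add: mat_adjoint_mult)
  with C have R3: "Re (trace_mat T3) = Re (trace_mat T2)"
    by (simp add: trace_mat_adjoint)
  have R4: "T4 i \<in> carrier_mat K K"
    "Re (trace_mat (T4 i)) = quad_trace (\<Sigma> i) (mat_adjoint G * H i * F i)" if i: "i \<in> {1..L}" for i
  proof -
    \<comment> \<open>\<open>B\<close> is everything to the left of \<open>\<Sigma> i\<close> in
      \<open>T4 i\<close>; the three factors to the right multiply to its adjoint.\<close>
    define B where "B = mat_adjoint G * H i * F i"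
    note c = H[OF i] F[OF i] n[OF i]
    note ca = mat_adjoint_carrier[OF c(1)] mat_adjoint_carrier[OF c(2)]
    have B: "B \<in> carrier_mat K (J i)"
      using GA c by (auto simp: B_def)
    have adj: "mat_adjoint B = mat_adjoint (F i) * (mat_adjoint (H i) * G)"
      using dims carrier_matD[OF c(1)] carrier_matD[OF c(2)]
      by (simp add: B_def mat_adjoint_mult)
    have X: "B * \<Sigma> i \<in> carrier_mat K (J i)" using B c by auto
    have Y: "mat_adjoint (H i) * G \<in> carrier_mat (N i) K" using ca G by auto
    have "T4 i = B * \<Sigma> i * mat_adjoint (F i) * (mat_adjoint (H i) * G)"
      unfolding T4_def B_def[symmetric]
      by (rule assoc_mult_mat[OF mult_carrier_mat[OF X ca(2)] ca(1) G])
    also have "\<dots> = B * \<Sigma> i * mat_adjoint B"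
      unfolding adj by (rule assoc_mult_mat[OF X ca(2) Y])
    finally have T: "T4 i = B * \<Sigma> i * mat_adjoint B" .
    show "T4 i \<in> carrier_mat K K"
      using T B c by auto
    show "Re (trace_mat (T4 i)) = quad_trace (\<Sigma> i) (mat_adjoint G * H i * F i)"
      using T by (simp add: quad_trace_def B_def)
  qed
  have R4sum: "trace_mat (msum K K T4 {1..L}) = (\<Sum>i\<in>{1..L}. trace_mat (T4 i))"
    by (rule trace_mat_msum) (rule R4(1))
  have "mse_trace L M K H Kc \<Sigma>s \<Sigma> \<sigma>0sq F G
      = trace_mat (T1 - T2 - T3 + msum K K T4 {1..L} + complex_of_real \<sigma>0sq \<cdot>\<^sub>m T5 + \<Sigma>s)"
    by (simp add: mse_trace_def Let_def S_def T1_def T2_def T3_def T4_def T5_def)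
  also have "\<dots> = trace_mat T1 - trace_mat T2 - trace_mat T3 + (\<Sum>i\<in>{1..L}. trace_mat (T4 i))
      + complex_of_real \<sigma>0sq * trace_mat T5 + trace_mat \<Sigma>s"
    using C s R4(1)
    by (simp add: trace_mat_add[of _ K] trace_mat_minus[of _ K] trace_mat_smult[of _ K]
        minus_carrier_mat R4sum del: One_nat_def)
  finally have "mse L M K H Kc \<Sigma>s \<Sigma> \<sigma>0sq F G = Re (trace_mat T1) - Re (trace_mat T2)
      - Re (trace_mat T3) + (\<Sum>i\<in>{1..L}. Re (trace_mat (T4 i)))
      + \<sigma>0sq * Re (trace_mat T5) + Re (trace_mat \<Sigma>s)"
    by (simp add: mse_def del: One_nat_def)
  also have "(\<Sum>i\<in>{1..L}. Re (trace_mat (T4 i)))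
      = (\<Sum>i\<in>{1..L}. quad_trace (\<Sigma> i) (mat_adjoint G * H i * F i))"
    by (rule sum.cong[OF refl R4(2)])
  finally show ?thesis
    by (simp add: R1 R3 T2_def T5_def S_def del: One_nat_def)
qed

text \<open>Each quadratic form is convex and is evaluated at a linear image of the precoders, so it
  stays convex; the cross term is linear and the rest is constant.\<close>

lemma mse_convex:
  assumes Kc: "\<And>i. i \<in> {1..L} \<Longrightarrow> Kc i \<in> carrier_mat (J i) K"
    and H: "\<And>i. i \<in> {1..L} \<Longrightarrow> H i \<in> carrier_mat M (N i)"
    and s: "hermitian_psd K \<Sigma>s"
    and n: "\<And>i. i \<in> {1..L} \<Longrightarrow> hermitian_psd (J i) (\<Sigma> i)"
    and G: "G \<in> carrier_mat M K"
  shows "fam_convex_on {1..L} (mat_families {1..L} N J) (\<lambda>F. mse L M K H Kc \<Sigma>s \<Sigma> \<sigma>0sq F G)"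
proof -
  have sc: "\<Sigma>s \<in> carrier_mat K K" "mat_adjoint \<Sigma>s = \<Sigma>s"
    and nc: "\<And>i. i \<in> {1..L} \<Longrightarrow> \<Sigma> i \<in> carrier_mat (J i) (J i)"
    using s n by (auto simp: hermitian_psd_def)
  note GA = mat_adjoint_carrier[OF G]
  have "mse L M K H Kc \<Sigma>s \<Sigma> \<sigma>0sq (fam_comb {1..L} u X v Y) G
      \<le> u * mse L M K H Kc \<Sigma>s \<Sigma> \<sigma>0sq X G + v * mse L M K H Kc \<Sigma>s \<Sigma> \<sigma>0sq Y G"
    if XY: "X \<in> mat_families {1..L} N J" "Y \<in> mat_families {1..L} N J"
      and uv: "0 \<le> u" "0 \<le> v" "u + v = 1" for X Y u v
  proof -
    let ?Z = "fam_comb {1..L} u X v Y"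
    let ?B = "\<lambda>F. mat_adjoint G * signal_mat L M K H Kc F"
    let ?Q = "\<lambda>F. \<Sum>i\<in>{1..L}. quad_trace (\<Sigma> i) (mat_adjoint G * H i * F i)"
    \<comment> \<open>The part independent of the precoders, including the receiver noise, since
      \<open>G\<close> is fixed.\<close>
    let ?c = "\<sigma>0sq * Re (trace_mat (mat_adjoint G * G)) + Re (trace_mat \<Sigma>s)"
    have fam: "F i \<in> carrier_mat (N i) (J i)"
      if "F \<in> mat_families {1..L} N J" "i \<in> {1..L}" for F i
      using that by (auto simp: mat_families_def)
    note X = fam[OF XY(1)] and Y = fam[OF XY(2)]
      and Z = fam_comb_in_mat_families[OF XY, of u v]
    have mse: "mse L M K H Kc \<Sigma>s \<Sigma> \<sigma>0sq F G
        = quad_trace \<Sigma>s (?B F) - 2 * Re (trace_mat (?B F * \<Sigma>s)) + ?Q F + ?c"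
      if "F \<in> mat_families {1..L} N J" for F
      using mse_eq_quad_trace[OF H fam[OF that] sc nc G] by simp
    have S: "signal_mat L M K H Kc F \<in> carrier_mat M K" for F
      by (simp add: signal_mat_def)
    have B: "?B F \<in> carrier_mat K K" for F
      by (rule mult_carrier_mat[OF GA S])
    have "signal_mat L M K H Kc ?Z
        = mat_comb u (signal_mat L M K H Kc X) v (signal_mat L M K H Kc Y)"
      using H Kc X Y by (rule signal_mat_fam_comb)
    then have BZ: "?B ?Z = mat_comb u (?B X) v (?B Y)"
      by (simp only: mult_mat_comb_right[OF S S GA])
    have quad: "quad_trace \<Sigma>s (?B ?Z) \<le> u * quad_trace \<Sigma>s (?B X) + v * quad_trace \<Sigma>s (?B Y)"
      unfolding BZ by (rule quad_trace_convex[OF B B s uv])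
    \<comment> \<open>Linearity gives an equality here, so the negative coefficient of this term in
      the error does no harm.\<close>
    have lin: "Re (trace_mat (?B ?Z * \<Sigma>s))
        = u * Re (trace_mat (?B X * \<Sigma>s)) + v * Re (trace_mat (?B Y * \<Sigma>s))"
      unfolding BZ mult_mat_comb_left[OF B B sc(1)]
        trace_mat_comb[OF mult_carrier_mat[OF B sc(1)] mult_carrier_mat[OF B sc(1)]]
      by simp
    have "?Q ?Z \<le> (\<Sum>i\<in>{1..L}. u * quad_trace (\<Sigma> i) (mat_adjoint G * H i * X i)
        + v * quad_trace (\<Sigma> i) (mat_adjoint G * H i * Y i))"
    proof (rule sum_mono)
      fix i assume i: "i \<in> {1..L}"
      note GH = mult_carrier_mat[OF GA H[OF i]]
      show "quad_trace (\<Sigma> i) (mat_adjoint G * H i * ?Z i)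
          \<le> u * quad_trace (\<Sigma> i) (mat_adjoint G * H i * X i)
            + v * quad_trace (\<Sigma> i) (mat_adjoint G * H i * Y i)"
        unfolding fam_comb_apply[OF i] mult_mat_comb_right[OF X[OF i] Y[OF i] GH]
        by (rule quad_trace_convex[OF mult_carrier_mat[OF GH X[OF i]]
              mult_carrier_mat[OF GH Y[OF i]] n[OF i] uv])
    qed
    also have "\<dots> = u * ?Q X + v * ?Q Y"
      by (simp add: sum.distrib sum_distrib_left)
    finally have noise: "?Q ?Z \<le> u * ?Q X + v * ?Q Y" .
    \<comment> \<open>The weights sum to 1, so the constant part contributes equally to both sides
      of the inequality.\<close>
    have "u * ?c + v * ?c = ?c"
      using uv(3) by (metis distrib_right mult_1)
    with quad lin noise show ?thesis
      unfolding mse[OF XY(1)] mse[OF XY(2)] mse[OF Z] distrib_left right_diff_distrib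
      by linarith
  qed
  then show ?thesis
    by (simp add: fam_convex_on_def fam_convex_def fam_comb_in_mat_families)
qed

text \<open>Each power bound is brought to the form g(F) <= 0 by subtracting \<open>P i\<close>, a
  constant shift that \<open>tx_power_convex\<close> already includes.\<close>

theorem theorem1:
  fixes L M K :: nat and N J :: "nat \<Rightarrow> nat"
    and Kc H \<Sigma> :: "nat \<Rightarrow> complex mat" and \<Sigma>s G :: "complex mat"
    and \<sigma>0sq :: real and P :: "nat \<Rightarrow> real"
  assumes "L > 0" and "M > 0" and "K > 0"
    and "\<And>i. i \<in> {1..L} \<Longrightarrow> N i > 0"
    and "\<And>i. i \<in> {1..L} \<Longrightarrow> J i > 0"
    and "\<And>i. i \<in> {1..L} \<Longrightarrow> Kc i \<in> carrier_mat (J i) K"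
    and "\<And>i. i \<in> {1..L} \<Longrightarrow> H i \<in> carrier_mat M (N i)"
    and "hermitian_psd K \<Sigma>s"
    and "\<And>i. i \<in> {1..L} \<Longrightarrow> hermitian_psd (J i) (\<Sigma> i)"
    and "\<sigma>0sq > 0"
    and "\<And>i. i \<in> {1..L} \<Longrightarrow> P i > 0"
    and "G \<in> carrier_mat M K"
  shows "convex_optimization_problem {1..L} (mat_families {1..L} N J)
           (\<lambda>F. mse L M K H Kc \<Sigma>s \<Sigma> \<sigma>0sq F G)
           {1..L} (\<lambda>i F. tx_power Kc \<Sigma>s \<Sigma> i F - P i)"
  unfolding convex_optimization_problem_def
proof (intro conjI ballI)
  show "fam_convex_on {1..L} (mat_families {1..L} N J) (\<lambda>F. mse L M K H Kc \<Sigma>s \<Sigma> \<sigma>0sq F G)"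
    by (rule mse_convex) (fact assms)+
  show "fam_convex_on {1..L} (mat_families {1..L} N J) (\<lambda>F. tx_power Kc \<Sigma>s \<Sigma> i F - P i)"
    if "i \<in> {1..L}" for i
    using that assms by (intro tx_power_convex) auto
qed

end
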